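(* Let $T=z^4+p_2z^2+p_0$ and $Q=z^2+q_1z+q_0$ define the torus $\mathcal{T}$ and the quadric $\mathcal{Q}$ as in the context, and let $\mathcal{C}_{\mathbb{R}}=\mathcal{T}\cap\mathcal{Q}$. Suppose $q_1\equiv 0$. Let $(x_0,y_0)$ be a singular point of the cutcurve $\Pi_z(\mathcal{C}_{\mathbb{R}})$ with $\Delta_{\mathcal{T}}(x_0,y_0)\neq 0$. Then $(x_0,y_0)$ is the projection under $\Pi_z$ of two singular points of $\mathcal{C}_{\mathbb{R}}$.
   Context: Fix real numbers $0<r<R$. Put $p_2(x,y)=2(R^2-r^2+x^2+y^2)$, $p_0(x,y)=(R^2+2Rr+r^2-x^2-y^2)(R^2-2Rr+r^2-x^2-y^2)$, $T=z^4+p_2z^2+p_0\in\mathbb{R}[x,y,z]$, and $\mathcal{T}=\{T=0\}\subset\mathbb{R}^3$ (a ring torus). Let $q_1=ex+fy+i$ and $q_0=ax^2+by^2+dxy+gx+hy+j$ with real coefficients, $Q=z^2+q_1z+q_0$, and $\mathcal{Q}=\{Q=0\}\subset\mathbb{R}^3$. Standing assumption: the quadric is irreducible, i.e. neither the square of a plane nor the union of two planes. $\Pi_z(x,y,z)=(x,y)$ and $\Delta_{\mathcal{T}}=p_0$. $\widetilde{\mathbf{S}_0}\in\mathbb{R}[x,y]$ is the resultant of $T$ and $Q$ with respect to $z$, explicitly $\widetilde{\mathbf{S}_0}=(q_0q_1^2+p_2q_0-q_0^2-p_0)^2+q_1^2(q_1^2+p_2-2q_0)(p_0-q_0^2)$;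 $\widehat{\mathbf{S}_0}$ is its squarefree part; and $\mathbf{S}_0=\widehat{\mathbf{S}_0}/\gcd(\widehat{\mathbf{S}_0},\,p_2+q_1^2-2q_0)$. The cutcurve is the set $\Pi_z(\mathcal{C}_{\mathbb{R}})$; it is contained in the curve $\mathbf{S}_0=0$. A singular point of the cutcurve is a point of the cutcurve at which both partial derivatives of the squarefree polynomial $\mathbf{S}_0$ vanish. Singular points of $\mathcal{C}_{\mathbb{R}}$: let $I(\mathcal{C}_{\mathbb{R}})=\{F\in\mathbb{R}[x,y,z]: F|_{\mathcal{C}_{\mathbb{R}}}=0\}$. A point of $\mathcal{C}_{\mathbb{R}}$ is singular if the Jacobian matrix of a system of generators of $I(\mathcal{C}_{\mathbb{R}})$ has rank $0$ or $1$ at the point, and regular if the rank is $2$. Isolated points of $\mathcal{C}_{\mathbb{R}}$ (in the Euclidean topology) are regarded as singular. *)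

theory Defs
  imports
    "HOL-Analysis.Analysis"
    "HOL-Computational_Algebra.Computational_Algebra"
    "HOL-Computational_Algebra.Field_as_Ring"
    "Subresultants.Resultant_Prelim"
begin

text \<open>
  \<open>real poly poly\<close> is \<open>\<real>[x][y]\<close> and \<open>real poly poly poly\<close> is \<open>\<real>[x][y][z]\<close>: the outermost
  variable is the last one, so a polynomial in \<open>z\<close> over \<open>\<real>[x,y]\<close> is literally a list of
  coefficients \<open>[: c0, c1, \<dots> :]\<close> with \<open>ci :: real poly poly\<close>.
\<close>

definition const2 :: "real \<Rightarrow> real poly poly" where
  "const2 c = [:[:c:]:]"

definition X2 :: "real poly poly" where
  "X2 = [:[:0, 1:]:]"

definition Y2 :: "real poly poly" where
  "Y2 = [:0, 1:]"

definition eval2 :: "real poly poly \<Rightarrow> real \<times> real \<Rightarrow> real" where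
  "eval2 p = (\<lambda>(x, y). poly (poly p [:y:]) x)"

definition eval3 :: "real poly poly poly \<Rightarrow> real \<times> real \<times> real \<Rightarrow> real" where
  "eval3 F = (\<lambda>(x, y, z). eval2 (poly F [:[:z:]:]) (x, y))"

definition dx2 :: "real poly poly \<Rightarrow> real poly poly" where
  "dx2 p = map_poly pderiv p"

definition dy2 :: "real poly poly \<Rightarrow> real poly poly" where
  "dy2 p = pderiv p"

definition dx3 :: "real poly poly poly \<Rightarrow> real poly poly poly" where
  "dx3 F = map_poly dx2 F"

definition dy3 :: "real poly poly poly \<Rightarrow> real poly poly poly" where
  "dy3 F = map_poly dy2 F"

definition dz3 :: "real poly poly poly \<Rightarrow> real poly poly poly" where
  "dz3 F = pderiv F"

definition proj_z :: "real \<times> real \<times> real \<Rightarrow> real \<times> real" where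
  "proj_z = (\<lambda>(x, y, z). (x, y))"


definition p2 :: "real \<Rightarrow> real \<Rightarrow> real poly poly" where
  "p2 R r = const2 2 * (const2 (R^2 - r^2) + X2^2 + Y2^2)"

definition p0 :: "real \<Rightarrow> real \<Rightarrow> real poly poly" where
  "p0 R r = (const2 (R^2 + 2*R*r + r^2) - X2^2 - Y2^2)
          * (const2 (R^2 - 2*R*r + r^2) - X2^2 - Y2^2)"

definition torus_poly :: "real \<Rightarrow> real \<Rightarrow> real poly poly poly" where
  "torus_poly R r = [: p0 R r, 0, p2 R r, 0, 1 :]"

definition quadric_poly :: "real poly poly \<Rightarrow> real poly poly \<Rightarrow> real poly poly poly" where
  "quadric_poly q1 q0 = [: q0, q1, 1 :]"

definition Delta_torus :: "real \<Rightarrow> real \<Rightarrow> real poly poly" where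
  "Delta_torus R r = p0 R r"

definition zero_set3 :: "real poly poly poly \<Rightarrow> (real \<times> real \<times> real) set" where
  "zero_set3 F = {P. eval3 F P = 0}"

definition int_curve ::
    "real \<Rightarrow> real \<Rightarrow> real poly poly \<Rightarrow> real poly poly \<Rightarrow> (real \<times> real \<times> real) set" where
  "int_curve R r q1 q0 = zero_set3 (torus_poly R r) \<inter> zero_set3 (quadric_poly q1 q0)"

definition cutcurve ::
    "real \<Rightarrow> real \<Rightarrow> real poly poly \<Rightarrow> real poly poly \<Rightarrow> (real \<times> real) set" where
  "cutcurve R r q1 q0 = proj_z ` int_curve R r q1 q0"


definition S0_tilde ::
    "real \<Rightarrow> real \<Rightarrow> real poly poly \<Rightarrow> real poly poly \<Rightarrow> real poly poly" where
  "S0_tilde R r q1 q0 = resultant (torus_poly R r) (quadric_poly q1 q0)"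

text \<open>
  The library's \<open>squarefree_part\<close> is a different notion: it drops every prime factor of even
  multiplicity.  Here each prime factor is kept exactly once, which determines the squarefree
  part up to a nonzero real constant; such a constant does not affect the vanishing of the
  polynomial or of its partial derivatives.
\<close>

definition sqfree :: "real poly poly \<Rightarrow> real poly poly" where
  "sqfree p = (if p = 0 then 0 else \<Prod>(prime_factors p))"

definition S0_hat ::
    "real \<Rightarrow> real \<Rightarrow> real poly poly \<Rightarrow> real poly poly \<Rightarrow> real poly poly" where
  "S0_hat R r q1 q0 = sqfree (S0_tilde R r q1 q0)"

definition S0 ::
    "real \<Rightarrow> real \<Rightarrow> real poly poly \<Rightarrow> real poly poly \<Rightarrow> real poly poly" where
  "S0 R r q1 q0 =
     S0_hat R r q1 q0 div gcd (S0_hat R r q1 q0) (p2 R r + q1^2 - const2 2 * q0)"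

definition cutcurve_singular ::
    "real \<Rightarrow> real \<Rightarrow> real poly poly \<Rightarrow> real poly poly \<Rightarrow> real \<times> real \<Rightarrow> bool" where
  "cutcurve_singular R r q1 q0 P \<longleftrightarrow>
     P \<in> cutcurve R r q1 q0 \<and>
     eval2 (dx2 (S0 R r q1 q0)) P = 0 \<and> eval2 (dy2 (S0 R r q1 q0)) P = 0"


definition vanishing_ideal :: "(real \<times> real \<times> real) set \<Rightarrow> real poly poly poly set" where
  "vanishing_ideal S = {F. \<forall>P\<in>S. eval3 F P = 0}"

text \<open>
  \<open>Modules.module.span (*) G\<close> is the ideal of \<open>\<real>[x,y,z]\<close> generated by \<open>G\<close>.
\<close>

definition generates :: "real poly poly poly set \<Rightarrow> real poly poly poly set \<Rightarrow> bool" where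
  "generates G I \<longleftrightarrow> Modules.module.span (*) G = I"

definition gradient3 :: "real poly poly poly \<Rightarrow> real \<times> real \<times> real \<Rightarrow> real \<times> real \<times> real" where
  "gradient3 F P = (eval3 (dx3 F) P, eval3 (dy3 F) P, eval3 (dz3 F) P)"

text \<open>
  The rank of the Jacobian matrix is its row rank.  It is meaningful for infinite systems as well.
\<close>

definition jacobian_rank :: "real poly poly poly set \<Rightarrow> real \<times> real \<times> real \<Rightarrow> nat" where
  "jacobian_rank G P = dim ((\<lambda>F. gradient3 F P) ` G)"

text \<open>
  At a point of \<open>S\<close> the rank does not depend on the system of generators; see
  \<open>jacobian_rank_generates\<close> below.
\<close>

definition singular_point :: "(real \<times> real \<times> real) set \<Rightarrow> real \<times> real \<times> real \<Rightarrow> bool" where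
  "singular_point S P \<longleftrightarrow>
     P \<in> S \<and>
     (P isolated_in S \<or>
      (\<forall>G. generates G (vanishing_ideal S) \<longrightarrow> jacobian_rank G P \<le> 1))"

lemma det_rows_Cons:
  fixes rs :: "'a :: comm_ring_1 list list"
  assumes len: "length rs = Suc n" and rows: "\<forall>xs\<in>set rs. length xs = Suc n"
  shows "det (mat_of_rows_list (Suc n) rs) =
    (\<Sum>i<Suc n. (-1)^i * hd (rs ! i) *
       det (mat_of_rows_list n (map tl (take i rs @ drop (Suc i) rs))))"
proof -
  let ?A = "mat_of_rows_list (Suc n) rs"
  have row: "length (rs ! i) = Suc n" if "i < Suc n" for i
    using that len rows by simp
  have del: "mat_delete ?A i 0 = mat_of_rows_list n (map tl (take i rs @ drop (Suc i) rs))"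
    if "i < Suc n" for i
    using that len row
    by (intro eq_matI) (auto simp: mat_delete_def mat_of_rows_list_def nth_append nth_tl)
  have "det ?A = (\<Sum>i<Suc n. ?A $$ (i, 0) * cofactor ?A i 0)"
    by (rule laplace_expansion_column) (auto simp: mat_of_rows_list_def len)
  also have "\<dots> = (\<Sum>i<Suc n. (-1)^i * hd (rs ! i) *
       det (mat_of_rows_list n (map tl (take i rs @ drop (Suc i) rs))))"
  proof (rule sum.cong[OF refl])
    fix i assume "i \<in> {..<Suc n}"
    then have i: "i < Suc n" by simp
    have "?A $$ (i, 0) = rs ! i ! 0"
      using i len by (simp add: mat_of_rows_list_def)
    also have "\<dots> = hd (rs ! i)"
      using row[OF i] by (cases "rs ! i") auto
    finally show "?A $$ (i, 0) * cofactor ?A i 0 = (-1)^i * hd (rs ! i) *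
       det (mat_of_rows_list n (map tl (take i rs @ drop (Suc i) rs)))"
      unfolding cofactor_def del[OF i] by simp
  qed
  finally show ?thesis .
qed

lemma det_rows_Nil: "det (mat_of_rows_list 0 ([] :: 'a :: comm_ring_1 list list)) = 1"
  by (rule det_dim_zero) (simp add: mat_of_rows_list_def)

lemma det_sylvester_rows:
  fixes u v q0 q1 :: "'a :: comm_ring_1"
  shows "det (mat_of_rows_list (Suc (Suc (Suc (Suc (Suc (Suc 0))))))
      [[1, 0, v, 0, u, 0],
       [0, 1, 0, v, 0, u],
       [1, q1, q0, 0, 0, 0],
       [0, 1, q1, q0, 0, 0],
       [0, 0, 1, q1, q0, 0],
       [0, 0, 0, 1, q1, q0]]) =
      (q0 * q1^2 + v * q0 - q0^2 - u)^2 + q1^2 * (q1^2 + v - 2 * q0) * (u - q0^2)"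
  by (simp add: det_rows_Cons[where n="Suc (Suc (Suc (Suc (Suc 0))))"],
      simp add: det_rows_Cons[where n="Suc (Suc (Suc (Suc 0)))"],
      simp add: det_rows_Cons[where n="Suc (Suc (Suc 0))"],
      simp add: det_rows_Cons[where n="Suc (Suc 0)"],
      simp add: det_rows_Cons[where n="Suc 0"],
      simp add: det_rows_Cons[where n="0"],
      simp add: det_rows_Nil,
      simp add: algebra_simps power2_eq_square)

lemma sylvester_rows:
  fixes u v q0 q1 :: "'a :: comm_ring_1"
  shows "sylvester_mat_sub 4 2 [:u, 0, v, 0, 1:] [:q0, q1, 1:] =
    mat_of_rows_list (Suc (Suc (Suc (Suc (Suc (Suc 0))))))
      [[1, 0, v, 0, u, 0],
       [0, 1, 0, v, 0, u],
       [1, q1, q0, 0, 0, 0],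
       [0, 1, q1, q0, 0, 0],
       [0, 0, 1, q1, q0, 0],
       [0, 0, 0, 1, q1, q0]]" (is "?S = ?M")
proof (rule eq_matI)
  fix i j assume "i < dim_row ?M" "j < dim_col ?M"
  then have i: "i < 6" and j: "j < 6"
    by (auto simp: mat_of_rows_list_def)
  have S: "?S $$ (i, j) = (if i < 2 then
     if i \<le> j \<and> j - i \<le> 4 then coeff [:u, 0, v, 0, 1:] (4 + i - j) else 0
   else if i - 2 \<le> j \<and> j \<le> i then coeff [:q0, q1, 1:] (i-j) else 0)"
    using i j unfolding sylvester_mat_sub_def by simp
  have M: "?M $$ (i, j) = [[1, 0, v, 0, u, 0],
     [0, 1, 0, v, 0, u],
     [1, q1, q0, 0, 0, 0],
     [0, 1, q1, q0, 0, 0],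
     [0, 0, 1, q1, q0, 0],
     [0, 0, 0, 1, q1, q0]] ! i ! j"
    using i j by (simp add: mat_of_rows_list_def)
  have "i \<in> {0,Suc 0,Suc(Suc 0),Suc(Suc(Suc 0)),Suc(Suc(Suc(Suc 0))),Suc(Suc(Suc(Suc(Suc 0))))}"
   "j \<in> {0,Suc 0,Suc(Suc 0),Suc(Suc(Suc 0)),Suc(Suc(Suc(Suc 0))),Suc(Suc(Suc(Suc(Suc 0))))}"
    using i j by auto
  then show "?S $$ (i, j) = ?M $$ (i, j)"
    unfolding S M insert_iff empty_iff
    by (elim disjE) (simp_all add: numeral_eq_Suc)
qed (simp_all add: mat_of_rows_list_def)

lemma S0_tilde_explicit:
  "S0_tilde R r q1 q0 =
     (q0 * q1^2 + p2 R r * q0 - q0^2 - p0 R r)^2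
     + q1^2 * (q1^2 + p2 R r - 2 * q0) * (p0 R r - q0^2)"
proof -
  define u v where "u = p0 R r" and "v = p2 R r"
  have deg: "degree [:u, 0, v, 0, 1:] = 4" "degree [:q0, q1, 1:] = 2"
    by simp_all
  have "S0_tilde R r q1 q0 = det (sylvester_mat_sub 4 2 [:u, 0, v, 0, 1:] [:q0, q1, 1:])"
    unfolding S0_tilde_def resultant_def sylvester_mat_def torus_poly_def quadric_poly_def
      u_def[symmetric] v_def[symmetric] deg ..
  also have "\<dots> = (q0 * q1^2 + v * q0 - q0^2 - u)^2 + q1^2 * (q1^2 + v - 2 * q0) * (u - q0^2)"
    unfolding sylvester_rows by (rule det_sylvester_rows)
  finally show ?thesis by (simp add: u_def v_def)
qed

lemma eval2_hom:
  "eval2 (p + q) P = eval2 p P + eval2 q P"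
  "eval2 (p * q) P = eval2 p P * eval2 q P"
  "eval2 0 P = 0"
  by (simp_all add: eval2_def split_beta)

lemma eval3_hom:
  "eval3 (F + G) P = eval3 F P + eval3 G P"
  "eval3 (F * G) P = eval3 F P * eval3 G P"
  "eval3 0 P = 0"
  by (simp_all add: eval3_def eval2_hom split_beta)

lemma map_poly_derivation:
  fixes D :: "'a :: comm_ring_1 \<Rightarrow> 'a"
  assumes add: "\<And>a b. D (a + b) = D a + D b"
    and mult: "\<And>a b. D (a * b) = D a * b + a * D b"
  shows "map_poly D (p + q) = map_poly D p + map_poly D q"
    and "map_poly D (p * q) = map_poly D p * q + p * map_poly D q"
proof -
  have D0: "D 0 = 0" using add[of 0 0] by simp
  have Dsum: "D (\<Sum>i\<in>A. f i) = (\<Sum>i\<in>A. D (f i))" for A and f :: "nat \<Rightarrow> 'a"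
    by (induction A rule: infinite_finite_induct) (auto simp: D0 add)
  show "map_poly D (p + q) = map_poly D p + map_poly D q"
    by (rule poly_eqI) (simp add: coeff_map_poly D0 add)
  show "map_poly D (p * q) = map_poly D p * q + p * map_poly D q"
    by (rule poly_eqI) (simp add: coeff_map_poly D0 coeff_mult Dsum mult sum.distrib)
qed

lemma d2_derivation:
  "dx2 (p + q) = dx2 p + dx2 q" "dx2 (p * q) = dx2 p * q + p * dx2 q"
  "dy2 (p + q) = dy2 p + dy2 q" "dy2 (p * q) = dy2 p * q + p * dy2 q"
proof -
  have "pderiv (a * b) = pderiv a * b + a * pderiv b" for a b :: "real poly"
    by (simp add: pderiv_mult algebra_simps)
  then show "dx2 (p + q) = dx2 p + dx2 q" "dx2 (p * q) = dx2 p * q + p * dx2 q"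
    unfolding dx2_def by (intro map_poly_derivation; simp add: pderiv_add)+
  show "dy2 (p + q) = dy2 p + dy2 q" "dy2 (p * q) = dy2 p * q + p * dy2 q"
    by (simp_all add: dy2_def pderiv_add pderiv_mult algebra_simps)
qed

lemma d3_derivation:
  "dx3 (F + G) = dx3 F + dx3 G" "dx3 (F * G) = dx3 F * G + F * dx3 G"
  "dy3 (F + G) = dy3 F + dy3 G" "dy3 (F * G) = dy3 F * G + F * dy3 G"
  "dz3 (F + G) = dz3 F + dz3 G" "dz3 (F * G) = dz3 F * G + F * dz3 G"
  unfolding dx3_def dy3_def dz3_def
  by (simp_all add: map_poly_derivation d2_derivation pderiv_add pderiv_mult algebra_simps)

lemma gradient3_hom:
  "gradient3 0 P = 0"
  "gradient3 (F + G) P = gradient3 F P + gradient3 G P"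
  "gradient3 (F * G) P = eval3 G P *\<^sub>R gradient3 F P + eval3 F P *\<^sub>R gradient3 G P"
proof -
  show *: "gradient3 (F + G) P = gradient3 F P + gradient3 G P" for F G
    by (simp add: gradient3_def d3_derivation eval3_hom)
  from *[of 0 0] show "gradient3 0 P = 0" by simp
  show "gradient3 (F * G) P = eval3 G P *\<^sub>R gradient3 F P + eval3 F P *\<^sub>R gradient3 G P"
    by (simp add: gradient3_def d3_derivation eval3_hom)
qed

text \<open>
  At a point of \<open>S\<close> all systems of generators of the vanishing ideal, among them the ideal
  itself, have the same Jacobian rank.
\<close>

lemma jacobian_rank_generates:
  assumes "generates G (vanishing_ideal S)" and "P \<in> S"
  shows "jacobian_rank G P = jacobian_rank (vanishing_ideal S) P"
proof -
  interpret ideal: Modules.module "(*) :: real poly poly poly \<Rightarrow> _"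
    by unfold_locales (simp_all add: algebra_simps)
  have span: "ideal.span G = vanishing_ideal S"
    using assms(1) by (simp add: generates_def)
  then have sub: "G \<subseteq> vanishing_ideal S"
    using ideal.span_superset by blast
  have "gradient3 F P \<in> span ((\<lambda>F. gradient3 F P) ` G)" if "F \<in> ideal.span G" for F
    using that
  proof (induction rule: ideal.span_induct_alt)
    case base
    show ?case by (simp add: gradient3_hom span_zero)
  next
    case (step c F H)
    have "eval3 F P = 0"
      using sub step(1) assms(2) by (auto simp: vanishing_ideal_def)
    then have "gradient3 (c * F + H) P = eval3 c P *\<^sub>R gradient3 F P + gradient3 H P"
      by (simp add: gradient3_hom)
    also have "\<dots> \<in> span ((\<lambda>F. gradient3 F P) ` G)"
      by (rule span_add[OF span_scale[OF span_base[OF imageI[OF step(1)]]] step(2)])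
    finally show ?case .
  qed
  then have "(\<lambda>F. gradient3 F P) ` vanishing_ideal S \<subseteq> span ((\<lambda>F. gradient3 F P) ` G)"
    using span by auto
  then have "span ((\<lambda>F. gradient3 F P) ` G) = span ((\<lambda>F. gradient3 F P) ` vanishing_ideal S)"
    using sub by (metis (no_types, lifting) image_mono span_mono span_minimal subspace_span
        subset_antisym)
  then show ?thesis
    unfolding jacobian_rank_def by (metis dim_span)
qed

end

theory Submission
  imports Defs
begin

text \<open>
  For \<open>q\<^sub>1 = 0\<close> the resultant is a square \<open>W\<^sup>2\<close>, where
  \<open>W = q\<^sub>0\<^sup>2 - p\<^sub>2 q\<^sub>0 + p\<^sub>0 = u\<^sup>2 - 4 R\<^sup>2 (x\<^sup>2 + y\<^sup>2)\<close> with
  \<open>u = q\<^sub>0 - p\<^sub>2/2\<close>, and the space curve is \<open>z\<^sup>2 = - q\<^sub>0, W = 0\<close>.  Over a point \<open>p\<close> of the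
  cutcurve with
  \<open>p\<^sub>0(p) \<noteq> 0\<close> it has exactly the two points \<open>z = \<plusminus> \<surd>(- q\<^sub>0(p))\<close>, so only their singularity has to
  be shown.  As \<open>p\<^sub>2 - 2 q\<^sub>0 = - 2 u\<close> is positive at \<open>p\<close>, the radical of \<open>W\<close> is the
  product of \<open>S\<^sub>0\<close> and a factor that does not vanish at \<open>p\<close>, so its gradient vanishes there.

  Dividing by \<open>z\<^sup>2 + q\<^sub>0\<close>, every \<open>F\<close> in the vanishing ideal is \<open>A + B z\<close> modulo the quadric,
  and the symmetry \<open>z \<mapsto> - z\<close> makes both \<open>A\<close> and \<open>B\<close> vanish on \<open>W = 0\<close> near \<open>p\<close>,
  where \<open>q\<^sub>0\<close> is negative.  If the
  gradients of all such \<open>A\<close> and \<open>B\<close> vanish at \<open>p\<close>, then the gradient of \<open>F\<close> is a multiple of that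
  of the quadric, and the Jacobian rank is at most 1.  Isolated points of the space curve being
  singular anyway, the theorem becomes a statement about real plane curves (lemma
  \<open>gradient_vanishes_at_singular_point\<close>): if \<open>p\<close> is not an isolated point of
  \<open>W = 0\<close>, a polynomial \<open>A\<close> vanishing on \<open>W = 0\<close> near \<open>p\<close> has gradient zero at \<open>p\<close>.

  This is not a formal consequence of the radical being singular: a smooth branch through \<open>p\<close> could
  carry all real points near \<open>p\<close>, with a second component of \<open>W\<close> having \<open>p\<close> as an isolated real
  point.  Lemma \<open>critical_prime_factor\<close> shows that this is the only obstruction, and it would force
  \<open>W\<close> to vanish to order three at \<open>p\<close>.  Lemma \<open>cone_section_with_vanishing_second_jet\<close> excludes
  it: a pullback of a quadratic cone by a quadratic polynomial that vanishes to order three is a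
  double line times a parabola, both smooth at \<open>p\<close>, so no prime factor of \<open>W\<close> is singular there.
\<close>

section \<open>Evaluation and differentiation of bivariate polynomials\<close>

lemma eval2_pCons: "eval2 (pCons c p) v = poly c (fst v) + snd v * eval2 p v"
  by (simp add: eval2_def split_beta)

lemma eval2_has_derivative:
  "(eval2 p has_derivative
     (\<lambda>h. eval2 (dx2 p) v * fst h + eval2 (dy2 p) v * snd h)) (at v)"
proof (induction p)
  case 0
  have "eval2 0 = (\<lambda>_. 0)" by (simp add: eval2_def split_beta fun_eq_iff)
  moreover have "dx2 0 = 0" "dy2 0 = 0" by (simp_all add: dx2_def dy2_def)
  ultimately show ?case by (simp add: eval2_hom)
next
  case (pCons c p)
  have "dx2 (pCons c p) = pCons (pderiv c) (dx2 p)"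
    using pCons.hyps by (simp add: dx2_def map_poly_pCons)
  moreover have "dy2 (pCons c p) = p + pCons 0 (dy2 p)"
    by (simp add: dy2_def pderiv_pCons)
  moreover have "eval2 (pCons c p) = (\<lambda>v. poly c (fst v) + snd v * eval2 p v)"
    by (simp add: eval2_pCons fun_eq_iff)
  moreover have c: "((\<lambda>v. poly c (fst v)) has_derivative (\<lambda>h. poly (pderiv c) (fst v) * fst h)) (at v)"
    by (rule has_derivative_compose[OF has_derivative_fst[OF has_derivative_ident]])
       (simp add: poly_DERIV has_field_derivative_imp_has_derivative)
  ultimately show ?case
    using has_derivative_add[OF c has_derivative_mult[OF has_derivative_snd[OF has_derivative_ident] pCons.IH]]
    by (simp add: eval2_pCons eval2_hom algebra_simps)
qed

lemma eval2_continuous: "continuous_on S (eval2 p)"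
  by (rule continuous_at_imp_continuous_on)
     (simp add: has_derivative_continuous[OF eval2_has_derivative])

declare eval2_hom [simp]

lemma eval2_ring_hom [simp]:
  "eval2 (p - q) v = eval2 p v - eval2 q v" "eval2 (- p) v = - eval2 p v"
  "eval2 1 v = 1" "eval2 (p ^ n) v = eval2 p v ^ n" "eval2 (const2 c) v = c"
  "eval2 X2 v = fst v" "eval2 Y2 v = snd v"
  by (simp_all add: eval2_def split_beta const2_def X2_def Y2_def)

lemma partial_basic [simp]:
  "dx2 (const2 c) = 0" "dx2 X2 = 1" "dx2 Y2 = 0"
  "dy2 (const2 c) = 0" "dy2 X2 = 0" "dy2 Y2 = 1"
  "dx2 1 = 0" "dy2 1 = 0" "dx2 0 = 0" "dy2 0 = 0"
proof -
  have "map_poly pderiv p = [:pderiv (coeff p 0), pderiv (coeff p 1):]" if "degree p \<le> 1"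
    for p :: "real poly poly"
    using that by (intro poly_eqI) (auto simp: coeff_map_poly coeff_pCons coeff_eq_0 split: nat.split)
  then show "dx2 (const2 c) = 0" "dx2 X2 = 1" "dx2 Y2 = 0" "dx2 1 = 0" "dx2 0 = 0"
    by (simp_all add: dx2_def const2_def X2_def Y2_def pderiv_pCons one_pCons)
qed (simp_all add: dy2_def const2_def X2_def Y2_def pderiv_pCons one_pCons)

lemma partial_ring [simp]:
  "dx2 (p - q) = dx2 p - dx2 q" "dy2 (p - q) = dy2 p - dy2 q"
  "dx2 (p^2) = 2 * p * dx2 p" "dy2 (p^2) = 2 * p * dy2 p"
  "dx2 2 = 0" "dy2 2 = 0"
proof -
  have eq: "p = (p - q) + q" for p q :: "real poly poly" by simp
  show "dx2 (p - q) = dx2 p - dx2 q" "dy2 (p - q) = dy2 p - dy2 q"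
    by (metis eq d2_derivation(1) add_diff_cancel_right', metis eq d2_derivation(3) add_diff_cancel_right')
  show "dx2 (p^2) = 2 * p * dx2 p" "dy2 (p^2) = 2 * p * dy2 p"
    by (simp_all add: power2_eq_square d2_derivation)
  have "(2::real poly poly) = 1 + 1" by simp
  then show "dx2 2 = 0" "dy2 2 = 0" by (simp_all only: d2_derivation partial_basic add_0)
qed

lemma eval2_2 [simp]: "eval2 2 v = 2"
  using eval2_hom(1)[of 1 1 v] by simp

lemma eval2_eqI:
  assumes "\<And>v. eval2 p v = eval2 q v"
  shows "p = q"
proof -
  have "poly p [:y:] = poly q [:y:]" for y
    unfolding poly_eq_poly_eq_iff[symmetric] fun_eq_iff
    using assms[of "(_, y)"] by (simp add: eval2_def)
  then have "range (\<lambda>y. [:y:]) \<subseteq> {c. poly (p - q) c = 0}" by auto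
  moreover have "infinite (range (\<lambda>y::real. [:y:]))"
    using infinite_UNIV_char_0 by (auto dest!: finite_imageD simp: inj_on_def)
  ultimately have "p - q = 0"
    using poly_roots_finite[of "p - q"] finite_subset by blast
  then show ?thesis by simp
qed

lemma eval2_dvd: "p dvd q \<Longrightarrow> eval2 p v = 0 \<Longrightarrow> eval2 q v = 0"
  by (auto elim!: dvdE)

lemma eval2_prod: "eval2 (\<Prod>i\<in>I. f i) v = (\<Prod>i\<in>I. eval2 (f i) v)"
  by (induction I rule: infinite_finite_induct) simp_all

section \<open>Zero sets of plane curves\<close>

text \<open>
  The polynomial takes both signs along its gradient, and a disc stays connected when finitely many
  points are removed; the intermediate value theorem then gives a further zero.
\<close>

lemma infinite_zeros_near_smooth_zero:
  assumes zero: "eval2 p v = 0" and smooth: "eval2 (dx2 p) v \<noteq> 0 \<or> eval2 (dy2 p) v \<noteq> 0"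
    and "0 < \<epsilon>"
  shows "infinite {w \<in> ball v \<epsilon>. eval2 p w = 0}"
proof
  assume fin: "finite {w \<in> ball v \<epsilon>. eval2 p w = 0}"
  define n where "n = (eval2 (dx2 p) v, eval2 (dy2 p) v)"
  define f where "f t = eval2 p (v + t *\<^sub>R n)" for t
  have n: "0 < norm n" using smooth by (auto simp: n_def prod_eq_iff)
  have pos: "0 < fst n * fst n + snd n * snd n"
    using smooth by (auto simp: n_def sum_squares_gt_zero_iff)
  have "(f has_derivative (\<lambda>h. eval2 (dx2 p) v * fst (h *\<^sub>R n) + eval2 (dy2 p) v * snd (h *\<^sub>R n))) (at 0)"
    unfolding f_def
    by (rule has_derivative_compose[where f="\<lambda>t. v + t *\<^sub>R n" and g="eval2 p"])
       (auto intro!: derivative_eq_intros eval2_has_derivative[of p v, simplified])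
  moreover have "(\<lambda>h. eval2 (dx2 p) v * fst (h *\<^sub>R n) + eval2 (dy2 p) v * snd (h *\<^sub>R n)) =
      (*) (fst n * fst n + snd n * snd n)"
    by (simp add: n_def fun_eq_iff algebra_simps)
  ultimately have "(f has_real_derivative (fst n * fst n + snd n * snd n)) (at 0)"
    by (simp only: has_field_derivative_def)
  then obtain d where "0 < d" and d: "\<And>h. 0 < h \<Longrightarrow> h < d \<Longrightarrow> f (-h) < 0 \<and> 0 < f h"
  proof -
    assume D: "(f has_real_derivative (fst n * fst n + snd n * snd n)) (at 0)"
    obtain d1 where "0 < d1" "\<And>h. 0 < h \<Longrightarrow> h < d1 \<Longrightarrow> f 0 < f (0 + h)"
      using DERIV_pos_inc_right[OF D pos] by auto
    moreover obtain d2 where "0 < d2" "\<And>h. 0 < h \<Longrightarrow> h < d2 \<Longrightarrow> f (0 - h) < f 0"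
      using DERIV_pos_inc_left[OF D pos] by auto
    ultimately show thesis
      using that[of "min d1 d2"] zero by (simp add: f_def)
  qed
  have "0 < min d (\<epsilon> / norm n)" using \<open>0 < d\<close> n \<open>0 < \<epsilon>\<close> by simp
  then obtain h where h: "0 < h" "h < d" "h < \<epsilon> / norm n"
    using dense[of 0 "min d (\<epsilon> / norm n)"] by auto
  have "h * norm n < \<epsilon>" using h n by (simp add: pos_less_divide_eq)
  then have in_ball: "v + h *\<^sub>R n \<in> ball v \<epsilon>" "v + (-h) *\<^sub>R n \<in> ball v \<epsilon>"
    using h by (auto simp: dist_norm)
  let ?Z = "{w \<in> ball v \<epsilon>. eval2 p w = 0}"
  have "connected (ball v \<epsilon> - ?Z)"
    by (intro connected_open_diff_countable) (insert countable_finite[OF fin], auto)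
  then have "connected (eval2 p ` (ball v \<epsilon> - ?Z))"
    using connected_continuous_image eval2_continuous by blast
  moreover have "f h \<in> eval2 p ` (ball v \<epsilon> - ?Z)" "f (-h) \<in> eval2 p ` (ball v \<epsilon> - ?Z)"
    using in_ball d[OF h(1,2)] unfolding f_def by (intro imageI; auto)+
  ultimately have "0 \<in> eval2 p ` (ball v \<epsilon> - ?Z)"
    using d[OF h(1,2)] unfolding connected_iff_interval by (meson less_imp_le)
  then show False by auto
qed

text \<open>
  A nonzero member \<open>m\<close> of least degree of the ideal \<open>(A, G)\<close> divides every member up to a
  constant, by pseudo-division.  Were its degree positive, a nonconstant prime \<open>A\<close> would divide
  \<open>m\<close> and hence \<open>G\<close>.
\<close>

lemma eliminate_outer_variable:
  fixes A G :: "'a::idom poly"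
  assumes "prime_elem A" and "\<not> A dvd G"
  obtains u v d where "u * A + v * G = [:d:]" and "d \<noteq> 0"
proof (cases "degree A = 0")
  case True
  then obtain d where "A = [:d:]" by (rule degree_eq_zeroE)
  moreover have "A \<noteq> 0" using assms(1) by auto
  ultimately show thesis using that[of 1 0 d] by simp
next
  case False
  define I where "I = {u * A + v * G | u v. True}"
  have I_mult: "s * p + t * q \<in> I" if "p \<in> I" "q \<in> I" for p q s t
  proof -
    from that obtain u v u' v' where "p = u * A + v * G" "q = u' * A + v' * G"
      by (auto simp: I_def)
    then have "s * p + t * q = (s * u + t * u') * A + (s * v + t * v') * G"
      by (simp add: algebra_simps)
    then show ?thesis by (auto simp: I_def)
  qed
  have AG: "A \<in> I" "G \<in> I"
    unfolding I_def
    by (simp, rule exI[of _ 1], rule exI[of _ 0], simp, simp, rule exI[of _ 0], rule exI[of _ 1], simp)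
  have "A \<noteq> 0" using assms(1) by auto
  then obtain m where m: "m \<in> I" "m \<noteq> 0" and min: "\<And>p. p \<in> I \<Longrightarrow> p \<noteq> 0 \<Longrightarrow> degree m \<le> degree p"
    using AG(1) ex_has_least_nat[of "\<lambda>p. p \<in> I \<and> p \<noteq> 0" A degree] by blast
  have dvd: "\<exists>c q. c \<noteq> 0 \<and> Polynomial.smult c p = m * q" if "p \<in> I" for p
  proof -
    define q s where "q = fst (pseudo_divmod p m)" and "s = snd (pseudo_divmod p m)"
    have qs: "pseudo_divmod p m = (q, s)" by (simp add: q_def s_def)
    let ?c = "coeff m (degree m) ^ (Suc (degree p) - degree m)"
    have eq: "Polynomial.smult ?c p = m * q + s" and s: "s = 0 \<or> degree s < degree m"
      using pseudo_divmod[OF m(2) qs] by auto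
    have "s = [:?c:] * p + (- q) * m"
      using eq by (simp add: algebra_simps)
    then have "s \<in> I" by (simp only: I_mult[OF that m(1)])
    then have "s = 0" using s min[of s] by fastforce
    then show ?thesis using eq m(2) by (intro exI[of _ ?c] exI[of _ q]) auto
  qed
  have "degree m = 0"
  proof (rule ccontr)
    assume deg: "degree m \<noteq> 0"
    obtain c q where c: "c \<noteq> 0" and q: "Polynomial.smult c A = m * q" using dvd[OF AG(1)] by auto
    have "A dvd m * q" unfolding q[symmetric] by (simp add: dvd_smult)
    then have "A dvd m"
    proof (cases "A dvd m")
      case False
      then have "A dvd q" using \<open>A dvd m * q\<close> assms(1) by (simp add: prime_elem_dvd_mult_iff)
      then obtain t where "q = A * t" ..
      have "A * [:c:] = A * (m * t)" using q unfolding \<open>q = A * t\<close> by (simp add: algebra_simps)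
      then have eq: "[:c:] = m * t" using \<open>A \<noteq> 0\<close> by (simp only: mult_cancel_left simp_thms)
      then have "m dvd [:c:]" by simp
      then have "degree m \<le> degree [:c:]" by (rule dvd_imp_degree_le) (simp add: c)
      then show ?thesis using deg by simp
    qed simp
    moreover obtain c' q' where c': "c' \<noteq> 0" and q': "Polynomial.smult c' G = m * q'" using dvd[OF AG(2)] by auto
    ultimately have "A dvd [:c':] * G" by (simp add: q')
    then have "A dvd [:c':]" using assms prime_elem_dvd_mult_iff by blast
    then have "degree A \<le> degree [:c':]" by (rule dvd_imp_degree_le) (simp add: c')
    with False show False by simp
  qed
  then obtain d where "m = [:d:]" by (rule degree_eq_zeroE)
  moreover obtain u v where "m = u * A + v * G" using m(1) by (auto simp: I_def)
  ultimately show thesis using m(2) that[of u v d] by simp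
qed

lemma const_linear_dvd_iff_root:
  fixes p :: "'a::idom poly poly"
  shows "[:[:-c, 1:]:] dvd p \<longleftrightarrow> map_poly (\<lambda>q. poly q c) p = 0"
  by (simp add: const_poly_dvd_iff poly_eq_iff coeff_map_poly poly_eq_0_iff_dvd)

text \<open>
  Elimination bounds the first coordinate of a common zero.  A vertical line with infinitely many
  common zeros would be a common component.
\<close>

lemma finite_common_zeros:
  assumes prime: "prime_elem A" and ndvd: "\<not> A dvd G"
  shows "finite {v. eval2 A v = 0 \<and> eval2 G v = 0}" (is "finite ?Z")
proof -
  obtain s t d where d: "s * A + t * G = [:d:]" "d \<noteq> 0"
    using eliminate_outer_variable[OF assms] .
  define Y where "Y c = {y. poly (map_poly (\<lambda>q. poly q c) A) y = 0 \<and>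
      poly (map_poly (\<lambda>q. poly q c) G) y = 0}" for c
  have "eval2 p (c, y) = poly (map_poly (\<lambda>q. poly q c) p) y" for p c y
    by (induction p) (simp_all add: eval2_hom eval2_pCons map_poly_pCons)
  moreover have "poly d (fst v) = 0" if "v \<in> ?Z" for v
  proof -
    have "eval2 (s * A + t * G) v = 0" using that by (simp add: eval2_hom)
    then show ?thesis unfolding d by (simp add: eval2_pCons eval2_hom)
  qed
  ultimately have sub: "?Z \<subseteq> (SIGMA c:{c. poly d c = 0}. Y c)"
    unfolding Y_def by force
  have "finite (Y c)" for c
  proof (rule ccontr)
    assume "infinite (Y c)"
    then have "map_poly (\<lambda>q. poly q c) A = 0" "map_poly (\<lambda>q. poly q c) G = 0"
      unfolding Y_def
      using poly_roots_finite[of "map_poly (\<lambda>q. poly q c) A"]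
        poly_roots_finite[of "map_poly (\<lambda>q. poly q c) G"]
      by (auto elim: finite_subset[rotated])
    then have A: "[:[:-c, 1:]:] dvd A" and G: "[:[:-c, 1:]:] dvd G"
      by (simp_all add: const_linear_dvd_iff_root)
    have "\<not> [:[:-c, 1:]:] dvd (1 :: real poly poly)"
      by (simp add: const_linear_dvd_iff_root map_poly_1')
    then have "A dvd [:[:-c, 1:]:]"
      using irreducibleD'[OF prime_elem_imp_irreducible[OF prime] A] by blast
    then show False using G ndvd dvd_trans by blast
  qed
  then show ?thesis
    using finite_subset[OF sub] poly_roots_finite[OF d(2)] by (simp add: finite_SigmaI)
qed


section \<open>Prime factors at a singular point of a curve\<close>

lemma prime_factor_through_zero:
  assumes "p \<noteq> 0" and "eval2 p v = 0"
  obtains q where "q \<in> prime_factors p" and "eval2 q v = 0"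
proof -
  have "eval2 (prod_mset M) v = 0 \<Longrightarrow> \<exists>q\<in>#M. eval2 q v = 0" for M
    by (induction M) auto
  moreover have "eval2 (prod_mset (prime_factorization p)) v = 0"
  proof (rule eval2_dvd[OF _ assms(2)])
    have "normalize (prod_mset (prime_factorization p)) = normalize p"
      by (rule prod_mset_prime_factorization_weak[OF assms(1)])
    then show "p dvd prod_mset (prime_factorization p)"
      using associated_iff_dvd by blast
  qed
  ultimately show thesis using that by blast
qed

lemma smooth_cofactor:
  assumes "A = B * C" and "eval2 B v = 0"
  shows "eval2 (dx2 A) v = eval2 (dx2 B) v * eval2 C v"
    and "eval2 (dy2 A) v = eval2 (dy2 B) v * eval2 C v"
  using assms by (simp_all add: d2_derivation)

text \<open>
  Only one prime factor \<open>A1\<close> of \<open>A\<close> passes through the smooth zero \<open>p\<close> of \<open>A\<close>, so the zeros of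
  \<open>W\<close> near \<open>p\<close> lie on \<open>A1 = 0\<close>.  They are infinitely many, hence \<open>A1\<close> divides \<open>W\<close>.  As the
  radical of \<open>W\<close> is singular at \<open>p\<close> while \<open>A1\<close> is not, a second prime factor \<open>A2\<close> passes through
  \<open>p\<close>.  It has only finitely many zeros near \<open>p\<close>, since these lie on \<open>A1 = 0\<close> too and the
  two primes are not associated; a curve that is smooth at \<open>p\<close> has infinitely many.
\<close>

lemma critical_prime_factor:
  fixes W A :: "real poly poly"
  assumes "W \<noteq> 0" and lim: "p islimpt {v. eval2 W v = 0}"
    and Wp: "eval2 W p = 0"
    and crit: "eval2 (dx2 (\<Prod>(prime_factors W))) p = 0" "eval2 (dy2 (\<Prod>(prime_factors W))) p = 0"
    and "0 < \<epsilon>" and vanish: "\<And>v. v \<in> ball p \<epsilon> \<Longrightarrow> eval2 W v = 0 \<Longrightarrow> eval2 A v = 0"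
    and smooth: "eval2 (dx2 A) p \<noteq> 0 \<or> eval2 (dy2 A) p \<noteq> 0"
  obtains A1 A2 where "A1 * A2 dvd W" "prime A2" "eval2 A1 p = 0"
    "eval2 A2 p = 0" "eval2 (dx2 A2) p = 0" "eval2 (dy2 A2) p = 0"
proof -
  have "A \<noteq> 0" using smooth by auto
  moreover have Ap: "eval2 A p = 0" using vanish Wp \<open>0 < \<epsilon>\<close> by simp
  ultimately obtain A1 where A1: "A1 \<in> prime_factors A" "eval2 A1 p = 0"
    by (rule prime_factor_through_zero)
  then have prime1: "prime A1" and "A1 dvd A" by auto
  then obtain C where C: "A = A1 * C" by (elim dvdE)
  note grad_A = smooth_cofactor[OF C A1(2)]
  from smooth grad_A have Cp: "eval2 C p \<noteq> 0" by auto
  have "isCont (eval2 C) p"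
    using has_derivative_continuous[OF eval2_has_derivative] .
  then obtain \<delta> where "0 < \<delta>" and C_ball: "\<And>v. v \<in> ball p \<delta> \<Longrightarrow> eval2 C v \<noteq> 0"
    using Cp continuous_at_avoid[of p "eval2 C" 0] by (auto simp: dist_commute)
  define \<rho> where "\<rho> = min \<delta> \<epsilon>"
  have \<rho>: "0 < \<rho>" using \<open>0 < \<delta>\<close> \<open>0 < \<epsilon>\<close> by (simp add: \<rho>_def)
  have on_A1: "eval2 A1 v = 0" if "v \<in> ball p \<rho>" "eval2 W v = 0" for v
    using vanish[of v] C_ball[of v] that by (auto simp: \<rho>_def C)
  have dvd_if: "A1 dvd G" if "infinite {v \<in> ball p \<rho>. eval2 G v = 0}"
      "\<And>v. eval2 G v = 0 \<Longrightarrow> eval2 W v = 0" for G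
  proof (rule ccontr)
    assume "\<not> A1 dvd G"
    then have "finite {v. eval2 A1 v = 0 \<and> eval2 G v = 0}"
      using finite_common_zeros prime1 prime_imp_prime_elem by blast
    moreover have "{v \<in> ball p \<rho>. eval2 G v = 0} \<subseteq> {v. eval2 A1 v = 0 \<and> eval2 G v = 0}"
      using on_A1 that(2) by auto
    ultimately show False using that(1) finite_subset by blast
  qed
  have "infinite ({v. eval2 W v = 0} \<inter> ball p \<rho>)"
    using lim \<rho> islimpt_eq_infinite_ball by blast
  then have "A1 dvd W"
    by (intro dvd_if) (simp_all add: Int_def conj_commute)
  then have A1W: "A1 \<in> prime_factors W"
    using prime1 \<open>W \<noteq> 0\<close> by (simp add: in_prime_factors_iff)
  let ?V = "\<Prod>(prime_factors W - {A1})"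
  have "\<Prod>(prime_factors W) = A1 * ?V"
    by (rule prod.remove) (use A1W in auto)
  from smooth_cofactor[OF this A1(2)] crit smooth grad_A have "eval2 ?V p = 0" by auto
  then obtain A2 where A2: "A2 \<in> prime_factors W - {A1}" "eval2 A2 p = 0"
    by (auto simp: eval2_prod)
  then have prime2: "prime A2" and "A2 dvd W" "A2 \<noteq> A1" by auto
  then have "coprime A1 A2" using prime1 primes_coprime by blast
  then have dvdW: "A1 * A2 dvd W" using \<open>A1 dvd W\<close> \<open>A2 dvd W\<close> by (rule divides_mult[rotated 2])
  have "\<not> (eval2 (dx2 A2) p \<noteq> 0 \<or> eval2 (dy2 A2) p \<noteq> 0)"
  proof
    assume "eval2 (dx2 A2) p \<noteq> 0 \<or> eval2 (dy2 A2) p \<noteq> 0"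
    from infinite_zeros_near_smooth_zero[OF A2(2) this \<rho>]
    have "A1 dvd A2" by (rule dvd_if) (rule eval2_dvd[OF \<open>A2 dvd W\<close>])
    then show False using prime1 prime2 \<open>A2 \<noteq> A1\<close> primes_dvd_imp_eq by blast
  qed
  then show thesis using that[OF dvdW prime2 A1(2) A2(2)] by blast
qed

lemma second_jet_of_product_vanishes:
  assumes "eval2 B p = 0" "eval2 A p = 0" "eval2 (dx2 A) p = 0" "eval2 (dy2 A) p = 0"
  shows "eval2 (dx2 (B * A)) p = 0" "eval2 (dy2 (B * A)) p = 0"
    "eval2 (dx2 (dx2 (B * A))) p = 0" "eval2 (dx2 (dy2 (B * A))) p = 0"
    "eval2 (dy2 (dy2 (B * A))) p = 0"
  using assms by (simp_all add: d2_derivation)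

section \<open>Pullbacks of a quadratic cone\<close>

text \<open>
  The pullback of the cone \<open>w\<^sup>2 = 4 R\<^sup>2 (x\<^sup>2 + y\<^sup>2)\<close> to the graph \<open>w = u(x, y)\<close>.
\<close>

definition cone_section :: "real \<Rightarrow> real poly poly \<Rightarrow> real poly poly" where
  "cone_section R u = u^2 - const2 (4 * R^2) * (X2^2 + Y2^2)"

text \<open>
  For \<open>u < 0\<close> at \<open>(x0, y0)\<close> and \<open>s = \<bar>(x0, y0)\<bar>\<close>, the vanishing of the 2-jet of \<open>u\<^sup>2 - 4 R\<^sup>2 (x\<^sup>2 + y\<^sup>2)\<close> at
  \<open>(x0, y0)\<close> says that \<open>u\<close> has there the 2-jet of the lower sheet \<open>- 2 R \<surd>(x\<^sup>2 + y\<^sup>2)\<close> of the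
  cone.  A quadratic polynomial is determined by its 2-jet, which gives
  \<open>s\<^sup>3 u = - R (2 n N + L\<^sup>2)\<close> with \<open>n = s\<^sup>2\<close>; the claim follows from the identity
  \<open>n (x\<^sup>2 + y\<^sup>2) = N\<^sup>2 + L\<^sup>2\<close>.
\<close>

lemma cone_section_with_vanishing_second_jet:
  fixes R a b d g h j x0 y0 :: real
  defines "n \<equiv> x0^2 + y0^2"
    and "L \<equiv> const2 x0 * Y2 - const2 y0 * X2"
    and "N \<equiv> const2 x0 * X2 + const2 y0 * Y2"
  assumes u: "u = const2 a * X2^2 + const2 b * Y2^2 + const2 d * X2 * Y2
              + const2 g * X2 + const2 h * Y2 + const2 j"
    and W: "W = cone_section R u"
    and "0 < R" and neg: "eval2 u (x0, y0) < 0"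
    and zero: "eval2 W (x0, y0) = 0"
    and first: "eval2 (dx2 W) (x0, y0) = 0" "eval2 (dy2 W) (x0, y0) = 0"
    and second: "eval2 (dx2 (dx2 W)) (x0, y0) = 0" "eval2 (dx2 (dy2 W)) (x0, y0) = 0"
      "eval2 (dy2 (dy2 W)) (x0, y0) = 0"
  shows "const2 (n^3) * W = const2 (R^2) * (L^2 * (const2 (4 * n) * (N - const2 n) + L^2))"
proof -
  define s where "s = sqrt n"
  have R0: "R \<noteq> 0" using \<open>0 < R\<close> by simp
  have "0 \<le> n" by (simp add: n_def)
  then have s2: "s^2 = n" "0 \<le> s" by (simp_all add: s_def)
  define u0 ux uy where "u0 = eval2 u (x0, y0)" and "ux = eval2 (dx2 u) (x0, y0)"
    and "uy = eval2 (dy2 u) (x0, y0)"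
  note u_defs = u0_def ux_def uy_def
  have ux_eq: "ux = 2 * a * x0 + d * y0 + g" and uy_eq: "uy = 2 * b * y0 + d * x0 + h"
    by (simp_all add: u_defs u d2_derivation)
  have hess: "eval2 (dx2 (dx2 u)) (x0, y0) = 2 * a" "eval2 (dx2 (dy2 u)) (x0, y0) = d"
    "eval2 (dy2 (dy2 u)) (x0, y0) = 2 * b"
    by (simp_all add: u d2_derivation)
  note W_defs = W cone_section_def d2_derivation
  have "u0^2 = (2 * R * s)^2"
    using zero unfolding W cone_section_def
    by (simp add: u0_def power_mult_distrib s2 n_def)
  moreover have "0 \<le> 2 * R * s" using \<open>0 < R\<close> s2(2) by simp
  ultimately have u0: "u0 = - (2 * R * s)"
    using neg unfolding u0_def[symmetric] power2_eq_iff by linarith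
  have "2 * u0 * ux = 8 * R^2 * x0" "2 * u0 * uy = 8 * R^2 * y0"
    using first by (simp_all add: W_defs u_defs)
  then have "R * (s * ux) = R * (- 2 * R * x0)" "R * (s * uy) = R * (- 2 * R * y0)"
    unfolding u0 by (simp_all add: power2_eq_square)
  then have ux: "s * ux = - 2 * R * x0" and uy: "s * uy = - 2 * R * y0"
    using R0 by (simp_all only: mult_cancel_left simp_thms)
  have "ux^2 + u0 * (2 * a) = 4 * R^2" "ux * uy + u0 * d = 0" "uy^2 + u0 * (2 * b) = 4 * R^2"
    using second by (simp_all add: W_defs hess u_defs[symmetric] power2_eq_square)
  then have "s^2 * (ux^2 + u0 * (2 * a)) = n * (4 * R^2)" "s^2 * (ux * uy + u0 * d) = 0"
    "s^2 * (uy^2 + u0 * (2 * b)) = n * (4 * R^2)"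
    by (simp_all add: s2)
  then have "(s * ux)^2 + s^2 * u0 * (2 * a) = n * (4 * R^2)" "(s * ux) * (s * uy) + s^2 * u0 * d = 0"
    "(s * uy)^2 + s^2 * u0 * (2 * b) = n * (4 * R^2)"
    by (simp_all add: algebra_simps power2_eq_square)
  then have "R * (s * n * a) = R * (- R * y0^2)" "R * (s * n * d) = R * (2 * R * x0 * y0)"
    "R * (s * n * b) = R * (- R * x0^2)"
    unfolding ux uy s2 u0 n_def by (simp_all add: algebra_simps power2_eq_square)
  then have a: "s * n * a = - R * y0^2" and d: "s * n * d = 2 * R * x0 * y0"
    and b: "s * n * b = - R * x0^2"
    using R0 by (simp_all only: mult_cancel_left simp_thms)
  have "s * n * g = n * (s * ux) - 2 * x0 * (s * n * a) - y0 * (s * n * d)"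
    by (simp add: ux_eq algebra_simps)
  then have g: "s * n * g = - 2 * R * n * x0"
    unfolding ux a d by (simp add: algebra_simps power2_eq_square)
  have "s * n * h = n * (s * uy) - 2 * y0 * (s * n * b) - x0 * (s * n * d)"
    by (simp add: uy_eq algebra_simps)
  then have h: "s * n * h = - 2 * R * n * y0"
    unfolding uy b d by (simp add: algebra_simps power2_eq_square)
  have "s * n * j = s * n * u0 - (s * n * a) * x0^2 - (s * n * b) * y0^2 - (s * n * d) * x0 * y0
      - (s * n * g) * x0 - (s * n * h) * y0"
    by (simp add: u0_def u algebra_simps)
  also have "\<dots> = - 2 * R * n * (s^2 - n)"
    unfolding a b d g h u0 by (simp add: n_def algebra_simps power2_eq_square)
  finally have j: "s * n * j = 0" by (simp add: s2)
  show ?thesis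
  proof (rule eval2_eqI)
    fix v :: "real \<times> real"
    obtain x y where v: "v = (x, y)" by fastforce
    define l m where "l = x0 * y - y0 * x" and "m = x0 * x + y0 * y"
    have "s * n * eval2 u v = (s * n * a) * x^2 + (s * n * b) * y^2 + (s * n * d) * x * y
      + (s * n * g) * x + (s * n * h) * y + s * n * j"
      by (simp add: u v algebra_simps)
    also have "\<dots> = - R * (2 * n * m + l^2)"
      unfolding a b d g h j by (simp add: l_def m_def algebra_simps power2_eq_square)
    finally have su: "s * n * eval2 u v = - R * (2 * n * m + l^2)" .
    have lagrange: "n * (x^2 + y^2) = m^2 + l^2"
      by (simp add: n_def l_def m_def algebra_simps power2_eq_square)
    have "n^3 * eval2 W v = s^2 * n^2 * (eval2 u v)^2 - 4 * R^2 * n^2 * (n * (x^2 + y^2))"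
      unfolding s2 by (simp add: W cone_section_def v algebra_simps power2_eq_square power3_eq_cube)
    also have "s^2 * n^2 * (eval2 u v)^2 = (s * n * eval2 u v)^2"
      by (simp add: power_mult_distrib)
    also have "(s * n * eval2 u v)^2 - 4 * R^2 * n^2 * (n * (x^2 + y^2)) =
        R^2 * (l^2 * (4 * n * (m - n) + l^2))"
      unfolding su lagrange by (simp add: algebra_simps power2_eq_square)
    finally show "eval2 (const2 (n^3) * W) v =
        eval2 (const2 (R^2) * (L^2 * (const2 (4 * n) * (N - const2 n) + L^2))) v"
      by (simp add: L_def N_def l_def m_def v)
  qed
qed


text \<open>
  Otherwise a prime factor \<open>A2\<close> of \<open>W\<close> is singular at \<open>p\<close> and another one passes through \<open>p\<close>, so
  that the 2-jet of \<open>W\<close> vanishes.  Then \<open>A2\<close> divides one of the factors \<open>L\<close>, \<open>M\<close> of \<open>W\<close>, both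
  of which have a nonzero gradient at \<open>p\<close>.
\<close>

lemma gradient_vanishes_at_singular_point:
  fixes R a b d g h j :: real and u W A :: "real poly poly"
  assumes u: "u = const2 a * X2^2 + const2 b * Y2^2 + const2 d * X2 * Y2
              + const2 g * X2 + const2 h * Y2 + const2 j"
    and W: "W = cone_section R u"
    and "0 < R" and neg: "eval2 u p < 0" and zero: "eval2 W p = 0"
    and lim: "p islimpt {v. eval2 W v = 0}"
    and crit: "eval2 (dx2 (\<Prod>(prime_factors W))) p = 0" "eval2 (dy2 (\<Prod>(prime_factors W))) p = 0"
    and "0 < \<epsilon>" and vanish: "\<And>v. v \<in> ball p \<epsilon> \<Longrightarrow> eval2 W v = 0 \<Longrightarrow> eval2 A v = 0"
  shows "eval2 (dx2 A) p = 0 \<and> eval2 (dy2 A) p = 0"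
proof (rule ccontr)
  assume smooth: "\<not> (eval2 (dx2 A) p = 0 \<and> eval2 (dy2 A) p = 0)"
  obtain x0 y0 where p: "p = (x0, y0)" by fastforce
  define n where "n = x0^2 + y0^2"
  define L where "L = const2 x0 * Y2 - const2 y0 * X2"
  define M where "M = const2 (4 * n) * (const2 x0 * X2 + const2 y0 * Y2 - const2 n) + L^2"
  have "0 < n"
  proof -
    have "(2 * R)^2 * n = (eval2 u p)^2"
      using zero by (simp add: W cone_section_def p n_def power_mult_distrib)
    moreover have "0 < (eval2 u p)^2" using neg by simp
    ultimately show ?thesis using \<open>0 < R\<close>
      by (metis zero_less_mult_pos zero_less_power mult_pos_pos zero_less_numeral)
  qed
  then have smooth_LM: "eval2 (dx2 L) p \<noteq> 0 \<or> eval2 (dy2 L) p \<noteq> 0"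
      "eval2 (dx2 M) p \<noteq> 0 \<or> eval2 (dy2 M) p \<noteq> 0"
    by (auto simp: L_def M_def p n_def d2_derivation)
  have factored: "const2 (n^3) * W = const2 (R^2) * (L^2 * M)"
    if "eval2 (dx2 W) p = 0" "eval2 (dy2 W) p = 0" "eval2 (dx2 (dx2 W)) p = 0"
      "eval2 (dx2 (dy2 W)) p = 0" "eval2 (dy2 (dy2 W)) p = 0"
    unfolding M_def L_def n_def
    by (rule cone_section_with_vanishing_second_jet[OF u W \<open>0 < R\<close>]) (use that neg zero p in auto)
  have "const2 (R^2) \<noteq> 0" using \<open>0 < R\<close> by (simp add: const2_def)
  moreover have "L \<noteq> 0" "M \<noteq> 0" using smooth_LM by auto
  (* the zero polynomial has a vanishing 2-jet, but L^2 * M is not zero *)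
  ultimately have "W \<noteq> 0" using factored by auto
  then obtain A1 A2 where A: "A1 * A2 dvd W" "prime A2" "eval2 A1 p = 0"
      "eval2 A2 p = 0" "eval2 (dx2 A2) p = 0" "eval2 (dy2 A2) p = 0"
    using critical_prime_factor[OF _ lim zero crit \<open>0 < \<epsilon>\<close> vanish] smooth by blast
  from A(1) obtain C where "W = A1 * A2 * C" by (elim dvdE)
  then have C: "W = (A1 * C) * A2" by (simp only: mult_ac)
  have "const2 (n^3) * W = const2 (R^2) * (L^2 * M)"
    by (rule factored) (use second_jet_of_product_vanishes[of "A1 * C" p A2] A C in simp_all)
  moreover have "A2 dvd const2 (n^3) * W" by (simp add: C)
  ultimately have "A2 dvd const2 (R^2) * (L^2 * M)" by simp
  moreover have "\<not> A2 dvd const2 (R^2)"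
    using A(4) eval2_dvd[of A2 "const2 (R^2)" p] \<open>0 < R\<close> by auto
  ultimately have "A2 dvd L \<or> A2 dvd M"
    using A(2) by (auto simp: prime_dvd_mult_iff prime_dvd_power_iff)
  moreover have "\<not> A2 dvd B" if "eval2 (dx2 B) p \<noteq> 0 \<or> eval2 (dy2 B) p \<noteq> 0" for B
    using that A smooth_cofactor[of B A2 _ p] by (auto elim!: dvdE)
  ultimately show False using smooth_LM by blast
qed

section \<open>The vanishing ideal of the space curve\<close>

lemma eval3_pCons: "eval3 (pCons c F) (x, y, z) = eval2 c (x, y) + z * eval3 F (x, y, z)"
  by (simp add: eval3_def) (simp add: eval2_def)

lemma divide_by_quadric:
  "\<exists>H A B. F = quadric_poly q1 q0 * H + [:A, B:]"
proof (induction F)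
  case 0
  show ?case by (rule exI[of _ 0])+ simp
next
  case (pCons c F)
  then obtain H A B where F: "F = quadric_poly q1 q0 * H + [:A, B:]" by blast
  have "pCons c F = quadric_poly q1 q0 * (pCons B H) + [:c - B * q0, A - B * q1:]"
    unfolding F quadric_poly_def by (simp add: algebra_simps)
  then show ?case by blast
qed

lemma gradient3_linear:
  "gradient3 [:A, B:] (x, y, z) =
    (eval2 (dx2 A) (x, y) + z * eval2 (dx2 B) (x, y),
     eval2 (dy2 A) (x, y) + z * eval2 (dy2 B) (x, y), eval2 B (x, y))"
proof -
  have "map_poly D [:A, B:] = [:D A, D B:]" if "D 0 = 0" for D :: "real poly poly \<Rightarrow> real poly poly"
    using that by (intro poly_eqI) (simp add: coeff_map_poly coeff_pCons split: nat.split)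
  then show ?thesis
    by (simp add: gradient3_def dx3_def dy3_def dz3_def pderiv_pCons eval3_pCons eval3_hom)
qed

lemma rank_le_1_if_gradients_parallel:
  assumes "\<And>F. F \<in> vanishing_ideal S \<Longrightarrow> \<exists>c. gradient3 F P = c *\<^sub>R w"
    and "generates G (vanishing_ideal S)" and "P \<in> S"
  shows "jacobian_rank G P \<le> 1"
proof -
  have "(\<lambda>F. gradient3 F P) ` vanishing_ideal S \<subseteq> span {w}"
    using assms(1) by (fastforce simp: span_singleton)
  then have "dim ((\<lambda>F. gradient3 F P) ` vanishing_ideal S) \<le> card {w}"
    by (rule dim_le_card) simp
  then show ?thesis
    using jacobian_rank_generates[OF assms(2,3)] by (simp add: jacobian_rank_def)
qed

section \<open>Singular points above a singular point of the cutcurve\<close>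

theorem proposition3p9:
  fixes R r a b d e f g h i j x0 y0 :: real
    and q1 q0 :: "real poly poly"
  assumes "0 < r" and "r < R"
    and "q1 = const2 e * X2 + const2 f * Y2 + const2 i"
    and "q0 = const2 a * X2^2 + const2 b * Y2^2 + const2 d * X2 * Y2
              + const2 g * X2 + const2 h * Y2 + const2 j"
    and "irreducible (quadric_poly q1 q0)"
    and "q1 = 0"
    and "cutcurve_singular R r q1 q0 (x0, y0)"
    and "eval2 (Delta_torus R r) (x0, y0) \<noteq> 0"
  shows "card {P. singular_point (int_curve R r q1 q0) P \<and> proj_z P = (x0, y0)} = 2"
proof -
  define p where "p = (x0, y0)"
  define u where "u = q0 - (const2 (R^2 - r^2) + X2^2 + Y2^2)"
  define W where "W = cone_section R u"
  define C where "C = int_curve R r q1 q0"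
  have "0 < R" using assms(1,2) by simp
  have "r^2 < R^2" using assms(1,2) by (simp add: power_strict_mono)
  have u_eq: "u = const2 (a - 1) * X2^2 + const2 (b - 1) * Y2^2 + const2 d * X2 * Y2
              + const2 g * X2 + const2 h * Y2 + const2 (j - (R^2 - r^2))"
    by (rule eval2_eqI) (simp add: u_def assms(4) algebra_simps)
  have eval_W: "eval2 W v = (eval2 q0 v)^2 - eval2 (p2 R r) v * eval2 q0 v + eval2 (p0 R r) v" for v
    by (simp add: W_def cone_section_def u_def p2_def p0_def algebra_simps power2_eq_square)
  have C_iff: "(x, y, z) \<in> C \<longleftrightarrow> z^2 = - eval2 q0 (x, y) \<and> eval2 W (x, y) = 0" for x y z
  proof -
    have "eval3 (quadric_poly q1 q0) (x, y, z) = z^2 + eval2 q0 (x, y)"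
      by (simp add: quadric_poly_def \<open>q1 = 0\<close> eval3_pCons eval3_hom power2_eq_square)
    moreover have "eval3 (torus_poly R r) (x, y, z) =
        (z^2)^2 + eval2 (p2 R r) (x, y) * z^2 + eval2 (p0 R r) (x, y)"
      by (simp add: torus_poly_def eval3_pCons eval3_hom power2_eq_square algebra_simps)
    ultimately have "(x, y, z) \<in> C \<longleftrightarrow> z^2 = - eval2 q0 (x, y) \<and>
        (z^2)^2 + eval2 (p2 R r) (x, y) * z^2 + eval2 (p0 R r) (x, y) = 0"
      by (auto simp only: C_def int_curve_def zero_set3_def mem_Collect_eq Int_iff eq_neg_iff_add_eq_0)
    also have "\<dots> \<longleftrightarrow> z^2 = - eval2 q0 (x, y) \<and> eval2 W (x, y) = 0"
      unfolding eval_W by (rule conj_cong[OF refl]) (simp only: power2_minus mult_minus_right add_uminus_conv_diff)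
    finally show ?thesis .
  qed
  have eval_u: "eval2 u v = eval2 q0 v - (R^2 - r^2 + (fst v)^2 + (snd v)^2)" for v
    by (simp add: u_def)
  have u_neg: "eval2 u v < 0" if "eval2 q0 v \<le> 0" for v
    using that \<open>r^2 < R^2\<close> zero_le_power2[of "fst v"] zero_le_power2[of "snd v"]
    unfolding eval_u by linarith
  have "p \<in> proj_z ` C"
    using assms(7) by (simp add: cutcurve_singular_def cutcurve_def C_def p_def)
  then obtain z0 where z0: "(x0, y0, z0) \<in> C" by (auto simp: proj_z_def p_def)
  then have Wp: "eval2 W p = 0" and z0_sq: "z0^2 = - eval2 q0 p" by (auto simp: C_iff p_def)
  have "z0 \<noteq> 0"
    using Wp z0_sq assms(8) by (auto simp: eval_W Delta_torus_def p_def)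
  then have q0p: "eval2 q0 p < 0" using z0_sq by (metis neg_0_less_iff_less zero_less_power2)
  have crit: "eval2 (dx2 (\<Prod>(prime_factors W))) p = 0 \<and> eval2 (dy2 (\<Prod>(prime_factors W))) p = 0"
  proof (cases "W = 0")
    case True
    then show ?thesis by simp
  next
    case False
    have "S0_tilde R r q1 q0 = W^2"
      by (rule eval2_eqI) (simp add: S0_tilde_explicit \<open>q1 = 0\<close> eval_W power2_commute algebra_simps power2_eq_square)
    moreover have "prime_factors (W^2) = prime_factors W"
      using False by (auto simp: in_prime_factors_iff prime_dvd_power_iff)
    ultimately have hat: "S0_hat R r q1 q0 = \<Prod>(prime_factors W)"
      using False by (simp add: S0_hat_def sqfree_def)
    define D where "D = gcd (S0_hat R r q1 q0) (p2 R r + q1^2 - const2 2 * q0)"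
    have "D dvd p2 R r + q1^2 - const2 2 * q0" by (simp add: D_def)
    moreover have "eval2 (p2 R r + q1^2 - const2 2 * q0) p = - 2 * eval2 u p"
      by (simp add: p2_def u_def \<open>q1 = 0\<close> algebra_simps)
    ultimately have Dp: "eval2 D p \<noteq> 0"
      using eval2_dvd[of D "p2 R r + q1^2 - const2 2 * q0" p] u_neg[of p] q0p by linarith
    have S0_D: "\<Prod>(prime_factors W) = S0 R r q1 q0 * D"
      unfolding hat[symmetric] S0_def D_def[symmetric] by (simp add: D_def)
    obtain q where "q \<in> prime_factors W" "eval2 q p = 0"
      using prime_factor_through_zero[OF False Wp] .
    then have "eval2 (\<Prod>(prime_factors W)) p = 0"
      by (auto simp: eval2_prod intro!: prod_zero)
    then have "eval2 (S0 R r q1 q0) p = 0" using Dp by (simp add: S0_D)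
    from smooth_cofactor[OF S0_D this] show ?thesis
      using assms(7) by (simp add: cutcurve_singular_def p_def)
  qed
  have singular: "singular_point C (x0, y0, z)" if "z^2 = - eval2 q0 p" for z
  proof -
    have P: "(x0, y0, z) \<in> C" using that Wp by (simp add: C_iff p_def)
    have "z \<noteq> 0" using that q0p by auto
    have rank: "jacobian_rank G (x0, y0, z) \<le> 1"
      if lim: "(x0, y0, z) islimpt C" and G: "generates G (vanishing_ideal C)" for G
    proof -
      have lim_p: "p islimpt {v. eval2 W v = 0}"
        unfolding islimpt_approachable
      proof (intro allI impI)
        fix \<epsilon> :: real assume "0 < \<epsilon>"
        (* closer to (x0, y0, z) than the mirror point (x0, y0, - z), which also lies above p *)
        then have "0 < min \<epsilon> \<bar>z\<bar>" using \<open>z \<noteq> 0\<close> by simp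
        then obtain x y z' where Q: "(x, y, z') \<in> C" "(x, y, z') \<noteq> (x0, y0, z)"
            "dist (x, y, z') (x0, y0, z) < min \<epsilon> \<bar>z\<bar>"
          using lim unfolding islimpt_approachable by (fast elim: prod_cases3)
        have "\<bar>z' - z\<bar> \<le> dist (x, y, z') (x0, y0, z)"
          using dist_snd_le[of "(x, y, z')" "(x0, y0, z)"]
            dist_snd_le[of "(y, z')" "(y0, z)"] by (simp add: dist_real_def)
        then have near: "\<bar>z' - z\<bar> < \<bar>z\<bar>" using Q(3) by simp
        have "(x, y) \<noteq> p"
        proof
          assume "(x, y) = p"
          then have "z'^2 = z^2" using Q(1) P by (simp add: C_iff p_def)
          then have "z' = z \<or> z' = - z" by (simp add: power2_eq_iff)
          then show False using near Q(2) \<open>(x, y) = p\<close> by (auto simp: p_def)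
        qed
        moreover have "dist (x, y) p \<le> dist (x, y, z') (x0, y0, z)"
          by (simp add: p_def dist_Pair_Pair)
        ultimately show "\<exists>v\<in>{v. eval2 W v = 0}. v \<noteq> p \<and> dist v p < \<epsilon>"
          using Q by (intro bexI[of _ "(x, y)"]) (auto simp: C_iff)
      qed
      obtain \<epsilon> where "0 < \<epsilon>" and q0_ball: "\<And>v. v \<in> ball p \<epsilon> \<Longrightarrow> eval2 q0 v < 0"
      proof -
        have "open {v. eval2 q0 v < 0}"
          using eval2_continuous[of UNIV q0] by (intro open_Collect_less) auto
        then obtain \<epsilon> where "0 < \<epsilon>" "ball p \<epsilon> \<subseteq> {v. eval2 q0 v < 0}"
          unfolding open_contains_ball using q0p by blast
        then show thesis using that by blast
      qed
      show ?thesis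
      proof (rule rank_le_1_if_gradients_parallel[OF _ G P])
        fix F assume F: "F \<in> vanishing_ideal C"
        obtain H A B where div: "F = quadric_poly q1 q0 * H + [:A, B:]"
          using divide_by_quadric by blast
        have AB: "eval2 A v = 0 \<and> eval2 B v = 0" if v: "v \<in> ball p \<epsilon>" "eval2 W v = 0" for v
        proof -
          obtain x y where xy: "v = (x, y)" by fastforce
          define t where "t = sqrt (- eval2 q0 v)"
          have t: "t^2 = - eval2 q0 v" "0 < t" using q0_ball[OF v(1)] by (simp_all add: t_def)
          have "eval2 A v + s * eval2 B v = 0" if "s^2 = - eval2 q0 v" for s
          proof -
            have "(x, y, s) \<in> C" using that v(2) by (simp add: C_iff xy)
            moreover from this have "eval3 (quadric_poly q1 q0) (x, y, s) = 0"
              by (simp add: C_def int_curve_def zero_set3_def)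
            ultimately show ?thesis
              using F unfolding vanishing_ideal_def div
              by (auto simp: eval3_hom eval3_pCons xy)
          qed
          from this[of t] this[of "- t"] t show ?thesis by auto
        qed
        have "eval2 A p = 0" "eval2 B p = 0" using AB[of p] \<open>0 < \<epsilon>\<close> Wp by auto
        moreover have "eval2 (dx2 E) p = 0 \<and> eval2 (dy2 E) p = 0" if "E = A \<or> E = B" for E
        proof (rule gradient_vanishes_at_singular_point[OF u_eq W_def \<open>0 < R\<close> _ Wp lim_p _ _ \<open>0 < \<epsilon>\<close>])
          show "eval2 u p < 0" using u_neg q0p by simp
          show "eval2 E v = 0" if "v \<in> ball p \<epsilon>" "eval2 W v = 0" for v
            using AB[OF that] \<open>E = A \<or> E = B\<close> by blast
        qed (simp_all only: crit)
        moreover have "eval3 (quadric_poly q1 q0) (x0, y0, z) = 0"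
          using P by (simp add: C_def int_curve_def zero_set3_def)
        ultimately have "gradient3 F (x0, y0, z) =
            eval3 H (x0, y0, z) *\<^sub>R gradient3 (quadric_poly q1 q0) (x0, y0, z)"
          unfolding div by (simp add: gradient3_hom gradient3_linear p_def zero_prod_def)
        then show "\<exists>c. gradient3 F (x0, y0, z) = c *\<^sub>R gradient3 (quadric_poly q1 q0) (x0, y0, z)" ..
      qed
    qed
    then show ?thesis
      using P unfolding singular_point_def isolated_in_islimpt_iff by blast
  qed
  have "{P. singular_point C P \<and> proj_z P = (x0, y0)} = {(x0, y0, z0), (x0, y0, - z0)}"
  proof (intro equalityI subsetI)
    fix P assume "P \<in> {P. singular_point C P \<and> proj_z P = (x0, y0)}"
    then obtain z where P: "P = (x0, y0, z)" "P \<in> C"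
      by (auto simp: singular_point_def proj_z_def split: prod.splits)
    then have "z^2 = z0^2" using z0_sq by (simp add: C_iff p_def)
    then show "P \<in> {(x0, y0, z0), (x0, y0, - z0)}" using P(1) by (auto simp: power2_eq_iff)
  next
    fix P assume "P \<in> {(x0, y0, z0), (x0, y0, - z0)}"
    then show "P \<in> {P. singular_point C P \<and> proj_z P = (x0, y0)}"
      using singular[of z0] singular[of "- z0"] z0_sq by (auto simp: proj_z_def)
  qed
  then show ?thesis using \<open>z0 \<noteq> 0\<close> by (simp add: C_def)
qed

end
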